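(* Let $(X_1,s^1)$ and $(X_2,s^2)$ be quandles. Then the quandle Euler characteristic of the interaction-free union $X_1\sqcup^{\mathrm{free}}X_2$ satisfies $$\chi^{\mathrm{Qdle}}(X_1\sqcup^{\mathrm{free}}X_2)\leq\chi^{\mathrm{Qdle}}(X_1)+\chi^{\mathrm{Qdle}}(X_2).$$
   Context: A quandle is a pair $(X,s)$ of a non-empty set $X$ and a map $s : X \to \mathrm{Map}(X,X)$, $x \mapsto s_x$ (where $\mathrm{Map}(X,X)$ is the set of all maps $X\to X$) such that: (1) $s_x(x)=x$ for all $x\in X$; (2) each $s_x$ is a bijection; (3) $s_x\circ s_y = s_{s_x(y)}\circ s_x$ for all $x,y\in X$. The displacement group $\mathrm{Dis}(X)$ is the group of bijections of $X$ generated under composition by $\{s_x\circ s_y^{-1} \mid x,y\in X\}$. For $g\in \mathrm{Dis}(X)$, $\mathrm{Fix}(g,X)=\{x\in X\mid g(x)=x\}$. The quandle Euler characteristic is $\chi^{\mathrm{Qdle}}(X)=\inf\{\#\mathrm{Fix}(g,X)\mid g\in \mathrm{Dis}(X)\}$, where $\#$ denotes cardinality (possibly infinite). The interaction-free union $X_1\sqcup^{\mathrm{free}}X_2$ of quandles $(X_1,s^1)$ and $(X_2,s^2)$ is the disjoint union $X_1\sqcup X_2$ with the quandle structure $s_x(y)=s^i_x(y)$ if $x,y$ both lie in $X_i$ ($i\in\{1,2\}$), and $s_x(y)=y$ if $x$ and $y$ lie in different components. *)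

theory Defs
  imports "HOL-Algebra.Bij" "HOL-Algebra.Generated_Groups"
begin

unbundle cardinal_syntax

text \<open>A quandle is a carrier set \<open>X\<close> with a map \<open>s\<close>; \<open>s x\<close> is the point symmetry at \<open>x\<close>, of which
  only the values on \<open>X\<close> matter.\<close>

locale quandle =
  fixes X :: "'a set" and s :: "'a \<Rightarrow> 'a \<Rightarrow> 'a"
  assumes nonempty: "X \<noteq> {}"
    and idem: "x \<in> X \<Longrightarrow> s x x = x"
    and bij: "x \<in> X \<Longrightarrow> bij_betw (s x) X X"
    and self_distrib: "\<lbrakk>x \<in> X; y \<in> X; z \<in> X\<rbrakk> \<Longrightarrow> s x (s y z) = s (s x y) (s x z)"

text \<open>\<open>BijGroup X\<close> consists of the bijections of \<open>X\<close> made undefined outside \<open>X\<close>, hence the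
  restrictions.\<close>

definition Dis :: "'a set \<Rightarrow> ('a \<Rightarrow> 'a \<Rightarrow> 'a) \<Rightarrow> ('a \<Rightarrow> 'a) set" where
  "Dis X s = generate (BijGroup X)
     {restrict (s x) X \<otimes>\<^bsub>BijGroup X\<^esub> inv\<^bsub>BijGroup X\<^esub> (restrict (s y) X) | x y. x \<in> X \<and> y \<in> X}"

definition Fix :: "('a \<Rightarrow> 'a) \<Rightarrow> 'a set \<Rightarrow> 'a set" where
  "Fix g X = {x \<in> X. g x = x}"

text \<open>Cardinals are represented by cardinal orders, which are determined up to \<open>=o\<close> only. As they are
  well-ordered by \<open>\<le>o\<close>, the infimum of a nonempty set of cardinals is its least element; the
  choice below is unique up to \<open>=o\<close>, and \<open>card_Inf_greatest\<close> confirms that it is the greatest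
  lower bound, also among cardinals living on other types.\<close>

definition card_Inf :: "'a rel set \<Rightarrow> 'a rel" where
  "card_Inf R = (SOME r. r \<in> R \<and> (\<forall>r' \<in> R. r \<le>o r'))"

lemma card_Inf:
  assumes "R \<noteq> {}" and "\<forall>r \<in> R. Card_order r"
  shows card_Inf_in: "card_Inf R \<in> R"
    and card_Inf_lower: "\<forall>r \<in> R. card_Inf R \<le>o r"
proof -
  have "\<exists>r. r \<in> R \<and> (\<forall>r' \<in> R. r \<le>o r')"
    using exists_minim_Well_order[of R] assms card_order_on_well_order_on by blast
  from someI_ex[OF this] show "card_Inf R \<in> R" and "\<forall>r \<in> R. card_Inf R \<le>o r"
    unfolding card_Inf_def by blast+
qed

lemma card_Inf_greatest:
  fixes R :: "'a rel set" and c :: "'b rel"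
  assumes "R \<noteq> {}" and "\<forall>r \<in> R. Card_order r" and "\<forall>r \<in> R. c \<le>o r"
  shows "c \<le>o card_Inf R"
  using card_Inf_in[OF assms(1,2)] assms(3) by blast

definition chi_Qdle :: "'a set \<Rightarrow> ('a \<Rightarrow> 'a \<Rightarrow> 'a) \<Rightarrow> 'a rel" where
  "chi_Qdle X s = card_Inf {|Fix g X| | g. g \<in> Dis X s}"

text \<open>The operation of the interaction-free union; its carrier is the disjoint union \<open>X1 <+> X2\<close>.\<close>

fun free_union_op ::
  "('a \<Rightarrow> 'a \<Rightarrow> 'a) \<Rightarrow> ('b \<Rightarrow> 'b \<Rightarrow> 'b) \<Rightarrow> 'a + 'b \<Rightarrow> 'a + 'b \<Rightarrow> 'a + 'b" where
  "free_union_op s1 s2 (Inl x) (Inl y) = Inl (s1 x y)"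
| "free_union_op s1 s2 (Inr x) (Inr y) = Inr (s2 x y)"
| "free_union_op s1 s2 (Inl x) (Inr y) = Inr y"
| "free_union_op s1 s2 (Inr x) (Inl y) = Inl y"

lemma bij_betw_map_sum:
  assumes "bij_betw f A A'" and "bij_betw g B B'"
  shows "bij_betw (map_sum f g) (A <+> B) (A' <+> B')"
  unfolding bij_betw_def
proof
  show "inj_on (map_sum f g) (A <+> B)"
    using assms by (intro inj_onI) (elim PlusE; auto simp: bij_betw_def dest: inj_onD)
  have "map_sum f g ` (A <+> B) = f ` A <+> g ` B"
    by (simp add: Plus_def image_Un image_image)
  then show "map_sum f g ` (A <+> B) = A' <+> B'"
    using assms by (simp add: bij_betw_def)
qed

lemma quandle_free_union:
  assumes "quandle X1 s1" and "quandle X2 s2"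
  shows "quandle (X1 <+> X2) (free_union_op s1 s2)"
proof -
  interpret A: quandle X1 s1 by fact
  interpret B: quandle X2 s2 by fact
  have inA: "s1 x y \<in> X1" if "x \<in> X1" "y \<in> X1" for x y
    using A.bij[OF that(1)] that(2) by (auto simp: bij_betw_def)
  have inB: "s2 x y \<in> X2" if "x \<in> X2" "y \<in> X2" for x y
    using B.bij[OF that(1)] that(2) by (auto simp: bij_betw_def)
  show ?thesis
  proof
    show "X1 <+> X2 \<noteq> {}" using A.nonempty by auto
  next
    fix x assume "x \<in> X1 <+> X2"
    then show "free_union_op s1 s2 x x = x" by (auto simp: A.idem B.idem)
  next
    fix x assume x: "x \<in> X1 <+> X2"
    have l: "free_union_op s1 s2 (Inl a) = map_sum (s1 a) id" for a
    proof
      fix u show "free_union_op s1 s2 (Inl a) u = map_sum (s1 a) id u" by (cases u) simp_all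
    qed
    have r: "free_union_op s1 s2 (Inr b) = map_sum id (s2 b)" for b
    proof
      fix u show "free_union_op s1 s2 (Inr b) u = map_sum id (s2 b) u" by (cases u) simp_all
    qed
    from x show "bij_betw (free_union_op s1 s2 x) (X1 <+> X2) (X1 <+> X2)"
    proof (elim PlusE)
      fix a assume "a \<in> X1" "x = Inl a"
      then show ?thesis using bij_betw_map_sum[OF A.bij bij_betw_id] by (simp add: l)
    next
      fix b assume "b \<in> X2" "x = Inr b"
      then show ?thesis using bij_betw_map_sum[OF bij_betw_id B.bij] by (simp add: r)
    qed
  next
    fix x y z assume "x \<in> X1 <+> X2" "y \<in> X1 <+> X2" "z \<in> X1 <+> X2"
    then show "free_union_op s1 s2 x (free_union_op s1 s2 y z) =
      free_union_op s1 s2 (free_union_op s1 s2 x y) (free_union_op s1 s2 x z)"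
      by (auto simp: A.self_distrib B.self_distrib)
  qed
qed

end

theory Submission
  imports Defs
begin

text \<open>
  Let \<open>X = X1 <+> X2\<close> carry the interaction-free union. The symmetry of \<open>X\<close> at a point of \<open>X1\<close> acts
  on \<open>X1\<close> as before and trivially on \<open>X2\<close>. Hence the homomorphism that extends a bijection of \<open>X1\<close>
  by the identity of \<open>X2\<close> sends each generator \<open>s\<^sub>x s\<^sub>y\<inverse>\<close> of \<open>Dis X1\<close> to a generator of \<open>Dis X\<close>, and so
  it sends \<open>Dis X1\<close> into \<open>Dis X\<close> (\<open>hom_image_Dis\<close>); the same holds for \<open>X2\<close>. The product of the
  extension of \<open>g1\<close> with the extension of \<open>g2\<close> is the bijection acting as \<open>g1\<close> on \<open>X1\<close> and as \<open>g2\<close>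
  on \<open>X2\<close>. It therefore lies in \<open>Dis X\<close> (\<open>block_sum_in_Dis\<close>), and its fixed points are those of
  \<open>g1\<close> together with those of \<open>g2\<close>. Taking for \<open>g1\<close> and \<open>g2\<close> elements with the fewest fixed points,
  which exist because cardinals are well-ordered, one obtains an element of \<open>Dis X\<close> with
  \<open>\<chi>(X1) + \<chi>(X2)\<close> fixed points.
\<close>

lemma Bij_restrict: "bij_betw f X X \<Longrightarrow> restrict f X \<in> Bij X"
  by (simp add: Bij_def bij_betw_restrict_eq)

lemma (in quandle) symmetry_in_BijGroup: "x \<in> X \<Longrightarrow> restrict (s x) X \<in> carrier (BijGroup X)"
  by (simp add: BijGroup_def Bij_restrict bij)

lemma (in quandle) Dis_subset_carrier: "Dis X s \<subseteq> carrier (BijGroup X)"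
  unfolding Dis_def
  by (rule group.generate_incl[OF group_BijGroup])
    (auto intro!: monoid.m_closed group.inv_closed symmetry_in_BijGroup
      simp: group_BijGroup group.is_monoid)

text \<open>Both summands embed in the same manner, so the argument is made once, for a homomorphism that
  turns point symmetries into point symmetries.\<close>

lemma hom_image_Dis:
  assumes "quandle X s"
    and "group_hom (BijGroup X) (BijGroup Y) h"
    and in_Y: "\<And>x. x \<in> X \<Longrightarrow> \<phi> x \<in> Y"
    and symm: "\<And>x. x \<in> X \<Longrightarrow> h (restrict (s x) X) = restrict (t (\<phi> x)) Y"
  shows "h ` Dis X s \<subseteq> Dis Y t"
proof -
  interpret quandle X s by fact
  interpret group_hom "BijGroup X" "BijGroup Y" h by fact
  let ?S = "{restrict (s x) X \<otimes>\<^bsub>BijGroup X\<^esub> inv\<^bsub>BijGroup X\<^esub> (restrict (s y) X)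
    | x y. x \<in> X \<and> y \<in> X}"
  let ?T = "{restrict (t x) Y \<otimes>\<^bsub>BijGroup Y\<^esub> inv\<^bsub>BijGroup Y\<^esub> (restrict (t y) Y)
    | x y. x \<in> Y \<and> y \<in> Y}"
  have "?S \<subseteq> carrier (BijGroup X)"
    using symmetry_in_BijGroup by auto
  then have "h ` Dis X s = generate (BijGroup Y) (h ` ?S)"
    unfolding Dis_def by (simp only: generate_img)
  also have "h ` ?S \<subseteq> ?T"
  proof
    fix g assume "g \<in> h ` ?S"
    then obtain x y where xy: "x \<in> X" "y \<in> X"
      and g: "g = h (restrict (s x) X \<otimes>\<^bsub>BijGroup X\<^esub> inv\<^bsub>BijGroup X\<^esub> (restrict (s y) X))"
      by blast
    have "g = restrict (t (\<phi> x)) Y \<otimes>\<^bsub>BijGroup Y\<^esub> inv\<^bsub>BijGroup Y\<^esub> (restrict (t (\<phi> y)) Y)"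
      using xy by (simp add: g symmetry_in_BijGroup flip: symm)
    then show "g \<in> ?T"
      using xy in_Y by blast
  qed
  then have "generate (BijGroup Y) (h ` ?S) \<subseteq> generate (BijGroup Y) ?T"
    by (rule H.mono_generate)
  finally show ?thesis
    unfolding Dis_def .
qed

definition block_sum :: "'a set \<Rightarrow> 'b set \<Rightarrow> ('a \<Rightarrow> 'a) \<Rightarrow> ('b \<Rightarrow> 'b) \<Rightarrow> 'a + 'b \<Rightarrow> 'a + 'b" where
  "block_sum A B f g = restrict (map_sum f g) (A <+> B)"

lemma block_sum_in_BijGroup:
  "f \<in> carrier (BijGroup A) \<Longrightarrow> g \<in> carrier (BijGroup B) \<Longrightarrow>
    block_sum A B f g \<in> carrier (BijGroup (A <+> B))"
  unfolding block_sum_def BijGroup_def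
  by (simp add: Bij_restrict bij_betw_map_sum Bij_def)

lemma block_sum_mult:
  assumes "f \<in> carrier (BijGroup A)" "f' \<in> carrier (BijGroup A)"
    and "g \<in> carrier (BijGroup B)" "g' \<in> carrier (BijGroup B)"
  shows "block_sum A B (f \<otimes>\<^bsub>BijGroup A\<^esub> f') (g \<otimes>\<^bsub>BijGroup B\<^esub> g') =
    block_sum A B f g \<otimes>\<^bsub>BijGroup (A <+> B)\<^esub> block_sum A B f' g'"
proof -
  have "f' \<in> A \<rightarrow> A" "g' \<in> B \<rightarrow> B"
    using assms by (auto simp: BijGroup_def dest: Bij_imp_funcset)
  then have "block_sum A B (compose A f f') (compose B g g') =
      compose (A <+> B) (block_sum A B f g) (block_sum A B f' g')"
    by (auto simp: fun_eq_iff block_sum_def compose_def)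
  then show ?thesis
    using assms block_sum_in_BijGroup[OF assms(1,3)] block_sum_in_BijGroup[OF assms(2,4)]
    by (simp add: BijGroup_def)
qed

lemma group_hom_block_sum_left:
  "group_hom (BijGroup A) (BijGroup (A <+> B)) (\<lambda>f. block_sum A B f \<one>\<^bsub>BijGroup B\<^esub>)"
proof -
  interpret B: group "BijGroup B" by (rule group_BijGroup)
  show ?thesis
    by (intro group_hom.intro group_hom_axioms.intro group_BijGroup homI)
      (simp_all add: block_sum_in_BijGroup flip: block_sum_mult)
qed

lemma group_hom_block_sum_right:
  "group_hom (BijGroup B) (BijGroup (A <+> B)) (block_sum A B \<one>\<^bsub>BijGroup A\<^esub>)"
proof -
  interpret A: group "BijGroup A" by (rule group_BijGroup)
  show ?thesis
    by (intro group_hom.intro group_hom_axioms.intro group_BijGroup homI)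
      (simp_all add: block_sum_in_BijGroup flip: block_sum_mult)
qed

text \<open>The block sum factors as \<open>(g1, 1)(1, g2)\<close>, and each factor is the image of a displacement under
  the embedding of one summand.\<close>

lemma block_sum_in_Dis:
  assumes "quandle X1 s1" and "quandle X2 s2"
    and g1: "g1 \<in> Dis X1 s1" and g2: "g2 \<in> Dis X2 s2"
  shows "block_sum X1 X2 g1 g2 \<in> Dis (X1 <+> X2) (free_union_op s1 s2)"
proof -
  let ?X = "X1 <+> X2" and ?s = "free_union_op s1 s2"
  interpret A: group "BijGroup X1" by (rule group_BijGroup)
  interpret B: group "BijGroup X2" by (rule group_BijGroup)
  interpret C: group "BijGroup ?X" by (rule group_BijGroup)
  interpret A: quandle X1 s1 by fact
  interpret B: quandle X2 s2 by fact
  interpret C: quandle ?X ?s using assms(1,2) by (rule quandle_free_union)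
  have carr: "g1 \<in> carrier (BijGroup X1)" "g2 \<in> carrier (BijGroup X2)"
    using g1 g2 A.Dis_subset_carrier B.Dis_subset_carrier by blast+
  have "(\<lambda>f. block_sum X1 X2 f \<one>\<^bsub>BijGroup X2\<^esub>) ` Dis X1 s1 \<subseteq> Dis ?X ?s"
    by (rule hom_image_Dis[where \<phi> = Inl, OF assms(1) group_hom_block_sum_left])
      (auto simp: block_sum_def BijGroup_def fun_eq_iff)
  then have left: "block_sum X1 X2 g1 \<one>\<^bsub>BijGroup X2\<^esub> \<in> Dis ?X ?s"
    using g1 by blast
  have "block_sum X1 X2 \<one>\<^bsub>BijGroup X1\<^esub> ` Dis X2 s2 \<subseteq> Dis ?X ?s"
    by (rule hom_image_Dis[where \<phi> = Inr, OF assms(2) group_hom_block_sum_right])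
      (auto simp: block_sum_def BijGroup_def fun_eq_iff)
  then have right: "block_sum X1 X2 \<one>\<^bsub>BijGroup X1\<^esub> g2 \<in> Dis ?X ?s"
    using g2 by blast
  have "block_sum X1 X2 g1 g2 =
      block_sum X1 X2 g1 \<one>\<^bsub>BijGroup X2\<^esub> \<otimes>\<^bsub>BijGroup ?X\<^esub> block_sum X1 X2 \<one>\<^bsub>BijGroup X1\<^esub> g2"
    using carr by (simp flip: block_sum_mult)
  also have "\<dots> \<in> Dis ?X ?s"
    using left right unfolding Dis_def by (rule generate.eng)
  finally show ?thesis .
qed

lemma Fix_block_sum: "Fix (block_sum A B f g) (A <+> B) = Fix f A <+> Fix g B"
  by (auto simp: Fix_def block_sum_def)

lemma chi_Qdle_attained:
  obtains g where "g \<in> Dis X s" and "chi_Qdle X s = |Fix g X|"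
proof -
  \<comment> \<open>The identity lies in \<open>Dis X s\<close>, so the infimum is over a nonempty set.\<close>
  have "\<one>\<^bsub>BijGroup X\<^esub> \<in> Dis X s"
    unfolding Dis_def by (rule generate.one)
  then have "chi_Qdle X s \<in> {|Fix g X| | g. g \<in> Dis X s}"
    unfolding chi_Qdle_def by (intro card_Inf_in) (auto simp: card_of_Card_order)
  then show thesis
    using that by blast
qed

lemma chi_Qdle_lower: "g \<in> Dis X s \<Longrightarrow> chi_Qdle X s \<le>o |Fix g X|"
  unfolding chi_Qdle_def
  by (rule bspec[OF card_Inf_lower]) (auto simp: card_of_Card_order)

theorem theorem1p9:
  fixes X1 :: "'a set" and s1 :: "'a \<Rightarrow> 'a \<Rightarrow> 'a"
    and X2 :: "'b set" and s2 :: "'b \<Rightarrow> 'b \<Rightarrow> 'b"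
  assumes "quandle X1 s1" and "quandle X2 s2"
  shows "chi_Qdle (X1 <+> X2) (free_union_op s1 s2) \<le>o chi_Qdle X1 s1 +c chi_Qdle X2 s2"
proof -
  obtain g1 where g1: "g1 \<in> Dis X1 s1" "chi_Qdle X1 s1 = |Fix g1 X1|"
    by (rule chi_Qdle_attained)
  obtain g2 where g2: "g2 \<in> Dis X2 s2" "chi_Qdle X2 s2 = |Fix g2 X2|"
    by (rule chi_Qdle_attained)
  have "chi_Qdle (X1 <+> X2) (free_union_op s1 s2)
      \<le>o |Fix (block_sum X1 X2 g1 g2) (X1 <+> X2)|"
    by (intro chi_Qdle_lower block_sum_in_Dis assms g1(1) g2(1))
  also have "Fix (block_sum X1 X2 g1 g2) (X1 <+> X2) = Fix g1 X1 <+> Fix g2 X2"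
    by (rule Fix_block_sum)
  also have "|Fix g1 X1 <+> Fix g2 X2| = chi_Qdle X1 s1 +c chi_Qdle X2 s2"
    by (simp add: csum_def Field_card_of g1(2) g2(2))
  finally show ?thesis .
qed

end
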